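(* Let $N\in\mathbb N$, $\Gamma=\Gamma_1(N)$, $\lambda\in\mathbb C$ and $s\in\mathbb N_0$. The space $U_{\lambda,s}^\Gamma$ of $\Gamma$-fixed points of $U_{\lambda,s}$ is finite-dimensional, and for every $\alpha\in\Delta_1(N)$ the eigenvalues of the Hecke operator $T_\alpha$ acting on $U_{\lambda,s}^\Gamma$ are algebraic over the field $F_\lambda=\mathbb Q(\lambda,\sqrt n,n^{\lambda/2}\mid n\in\mathbb N)$.
   Context: For $x>0$, $\mu\in\mathbb C$, $x^\mu=e^{\mu\log x}$. $\Delta_1(N)$ is the set of integer matrices $\begin{pmatrix}a&b\\c&d\end{pmatrix}$ of positive determinant with $a\equiv1$, $c\equiv0\pmod N$. $\mathbf T=\mathbb R/\pi\mathbb Z$. For $\gamma=\begin{pmatrix}a&b\\c&d\end{pmatrix}\in\mathrm{GL}_2^+(\mathbb R)$: $j(\gamma,\theta)=((a\cos\theta+b\sin\theta)^2+(c\cos\theta+d\sin\theta)^2)^{1/2}$; $\gamma.\theta\in\mathbf T$ determined by $(\cos\gamma.\theta,\sin\gamma.\theta)=\pm(a\cos\theta+b\sin\theta,c\cos\theta+d\sin\theta)/j(\gamma,\theta)$. $\partial=1+\frac{d}{d\theta}$. Functions $u^{s,j}_\gamma$: $u^{s,j}_\gamma=0$ for $j<0$ or $j>s$, $u^{0,0}_\gamma=j(\gamma,\theta)^{-1-\lambda}$, $u^{s+1,j}_\gamma=\partial u^{s,j}_\gamma+(\det\gamma)j(\gamma,\theta)^{-2}(u^{s,j-1}_\gamma-u^{s,j}_\gamma)$.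 $A^{(s)}_\gamma(\theta)$: the $(s+1)\times(s+1)$ matrix with entries $(\det\gamma)^{-\lambda/2}j(\gamma,\theta)^{-2}u^{\mu,\nu}_{\gamma^{-1}}(\gamma.\theta)$, $0\le\mu,\nu\le s$. $U_{\lambda,s}$: the space of $(s+1)$-tuples $\mathbf f=(f_0,\dots,f_s)$ of continuous functions on $\mathbf T$ with absolutely convergent Fourier series, with right $\mathrm{GL}_2^+(\mathbb R)$-action $(\mathbf f\mid_\lambda\gamma)(\theta)=(f_0(\gamma.\theta),\dots,f_s(\gamma.\theta))A^{(s)}_\gamma(\theta)$. For $\alpha\in\Delta_1(N)$ with $\Gamma\alpha\Gamma=\bigsqcup_{\mu=1}^r\Gamma\alpha_\mu$, the Hecke operator on $U_{\lambda,s}^\Gamma$ is $\mathbf f\mid T_\alpha=\sum_{\mu=1}^r\mathbf f\mid_\lambda\alpha_\mu$. *)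

theory Defs
  imports
    "HOL-Analysis.Analysis"
    "HOL-Computational_Algebra.Polynomial"
    "HOL-Library.Function_Algebras"
    "HOL-Number_Theory.Cong"
begin

definition Gamma1 :: "nat \<Rightarrow> (int^2^2) set" where
  "Gamma1 N = {A. det A = 1 \<and> [A$1$1 = 1] (mod int N) \<and> [A$2$2 = 1] (mod int N)
                  \<and> [A$2$1 = 0] (mod int N)}"

definition Delta1 :: "nat \<Rightarrow> (int^2^2) set" where
  "Delta1 N = {A. det A > 0 \<and> [A$1$1 = 1] (mod int N) \<and> [A$2$1 = 0] (mod int N)}"

definition double_coset :: "nat \<Rightarrow> int^2^2 \<Rightarrow> (int^2^2) set" where
  "double_coset N A = {G ** A ** H | G H. G \<in> Gamma1 N \<and> H \<in> Gamma1 N}"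

definition Gamma1_coset :: "nat \<Rightarrow> int^2^2 \<Rightarrow> (int^2^2) set" where
  "Gamma1_coset N A = {G ** A | G. G \<in> Gamma1 N}"

text \<open>\<open>R = {\<alpha>\<^sub>1, \<dots>, \<alpha>\<^sub>r}\<close> is a set of representatives in the decomposition
  of \<open>\<Gamma>\<alpha>\<Gamma>\<close> into a disjoint union of cosets \<open>\<Gamma>\<alpha>\<^sub>\<mu>\<close>.\<close>

definition coset_representatives :: "nat \<Rightarrow> int^2^2 \<Rightarrow> (int^2^2) set \<Rightarrow> bool" where
  "coset_representatives N A R \<longleftrightarrow>
     finite R \<and> disjoint_family_on (Gamma1_coset N) R \<and>
     double_coset N A = (\<Union>B\<in>R. Gamma1_coset N B)"

text \<open>Functions on \<open>\<real> / \<pi>\<int>\<close> are \<open>\<pi>\<close>-periodic functions on \<open>\<real>\<close>.  A point of the quotient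
  is represented by the element of its class in \<open>[0, \<pi>)\<close>. For real \<open>x > 0\<close>, the library's
  \<^term>\<open>complex_of_real x powr \<mu>\<close> is \<^term>\<open>exp (\<mu> * complex_of_real (ln x))\<close>.\<close>

definition jfac :: "real^2^2 \<Rightarrow> real \<Rightarrow> real" where
  "jfac g \<theta> = sqrt ((g$1$1 * cos \<theta> + g$1$2 * sin \<theta>)\<^sup>2 + (g$2$1 * cos \<theta> + g$2$2 * sin \<theta>)\<^sup>2)"

definition angle_act :: "real^2^2 \<Rightarrow> real \<Rightarrow> real" where
  "angle_act g \<theta> = (THE \<phi>. 0 \<le> \<phi> \<and> \<phi> < pi \<and>
     (\<exists>\<epsilon>\<in>{1, -1}. cos \<phi> = \<epsilon> * ((g$1$1 * cos \<theta> + g$1$2 * sin \<theta>) / jfac g \<theta>) \<and>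
                  sin \<phi> = \<epsilon> * ((g$2$1 * cos \<theta> + g$2$2 * sin \<theta>) / jfac g \<theta>)))"

definition del :: "(real \<Rightarrow> complex) \<Rightarrow> real \<Rightarrow> complex" where
  "del h \<theta> = h \<theta> + vector_derivative h (at \<theta>)"

primrec ufun :: "real^2^2 \<Rightarrow> complex \<Rightarrow> nat \<Rightarrow> int \<Rightarrow> real \<Rightarrow> complex" where
  "ufun g lam 0 =
     (\<lambda>j \<theta>. if j = 0 then complex_of_real (jfac g \<theta>) powr (-1 - lam) else 0)"
| "ufun g lam (Suc s) =
     (\<lambda>j \<theta>. if j < 0 \<or> int (Suc s) < j then 0
             else del (ufun g lam s j) \<theta>
                  + complex_of_real (det g / (jfac g \<theta>)\<^sup>2)
                    * (ufun g lam s (j - 1) \<theta> - ufun g lam s j \<theta>))"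

text \<open>The entry in row \<open>\<mu>\<close> and column \<open>\<nu>\<close> of the matrix \<open>A\<close>; it does not depend on its size.\<close>

definition Aentry :: "real^2^2 \<Rightarrow> complex \<Rightarrow> real \<Rightarrow> nat \<Rightarrow> nat \<Rightarrow> complex" where
  "Aentry g lam \<theta> \<mu> \<nu> =
     complex_of_real (det g) powr (- lam / 2) * complex_of_real (1 / (jfac g \<theta>)\<^sup>2)
     * ufun (matrix_inv g) lam \<mu> (int \<nu>) (angle_act g \<theta>)"

text \<open>An \<open>(s+1)\<close>-tuple \<open>(f\<^sub>0, \<dots>, f\<^sub>s)\<close> is a function \<open>f\<close> with \<open>f j = 0\<close> for \<open>j > s\<close>.\<close>

type_synonym tuple = "nat \<Rightarrow> real \<Rightarrow> complex"

definition slash :: "complex \<Rightarrow> nat \<Rightarrow> tuple \<Rightarrow> real^2^2 \<Rightarrow> tuple" where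
  "slash lam s f g =
     (\<lambda>\<nu> \<theta>. if \<nu> \<le> s then \<Sum>\<mu>\<le>s. f \<mu> (angle_act g \<theta>) * Aentry g lam \<theta> \<mu> \<nu> else 0)"

definition fourier_coeff :: "(real \<Rightarrow> complex) \<Rightarrow> int \<Rightarrow> complex" where
  "fourier_coeff h n =
     complex_of_real (1 / pi) * integral {0..pi} (\<lambda>\<theta>. h \<theta> * cis (- 2 * of_int n * \<theta>))"

definition abs_conv_fourier :: "(real \<Rightarrow> complex) set" where
  "abs_conv_fourier = {h. (\<forall>\<theta>. h (\<theta> + pi) = h \<theta>) \<and> continuous_on UNIV h \<and>
                          (\<lambda>n. norm (fourier_coeff h n)) summable_on UNIV}"

definition U_space :: "nat \<Rightarrow> tuple set" where
  "U_space s = {f. (\<forall>j\<le>s. f j \<in> abs_conv_fourier) \<and> (\<forall>j>s. f j = (\<lambda>\<theta>. 0))}"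

definition U_fixed :: "nat \<Rightarrow> complex \<Rightarrow> nat \<Rightarrow> tuple set" where
  "U_fixed N lam s =
     {f \<in> U_space s. \<forall>G\<in>Gamma1 N. slash lam s f (map_matrix real_of_int G) = f}"

text \<open>The Hecke operator of \<open>\<alpha>\<close>, computed from a set \<open>R\<close> of representatives for \<open>\<Gamma>\<alpha>\<Gamma>\<close>.\<close>

definition hecke :: "complex \<Rightarrow> nat \<Rightarrow> (int^2^2) set \<Rightarrow> tuple \<Rightarrow> tuple" where
  "hecke lam s R f = (\<Sum>B\<in>R. slash lam s f (map_matrix real_of_int B))"

definition tuple_scale :: "complex \<Rightarrow> tuple \<Rightarrow> tuple" where
  "tuple_scale c f = (\<lambda>j \<theta>. c * f j \<theta>)"

interpretation tuple: vector_space tuple_scale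
  by unfold_locales (auto simp: tuple_scale_def fun_eq_iff algebra_simps)

definition finite_dim :: "tuple set \<Rightarrow> bool" where
  "finite_dim V \<longleftrightarrow> (\<exists>B. finite B \<and> tuple.span B = V)"

definition eigenvalues_on :: "tuple set \<Rightarrow> (tuple \<Rightarrow> tuple) \<Rightarrow> complex set" where
  "eigenvalues_on V T = {c. \<exists>f\<in>V. f \<noteq> 0 \<and> T f = tuple_scale c f}"

definition is_subfield :: "complex set \<Rightarrow> bool" where
  "is_subfield K \<longleftrightarrow> 0 \<in> K \<and> 1 \<in> K \<and>
     (\<forall>x\<in>K. \<forall>y\<in>K. x + y \<in> K \<and> x * y \<in> K) \<and> (\<forall>x\<in>K. - x \<in> K \<and> inverse x \<in> K)"

definition F_field :: "complex \<Rightarrow> complex set" where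
  "F_field lam = is_subfield hull
     ({lam} \<union> {complex_of_real (sqrt (real n)) | n::nat. n > 0}
            \<union> {complex_of_real (real n) powr (lam / 2) | n::nat. n > 0})"

definition algebraic_over :: "complex set \<Rightarrow> complex \<Rightarrow> bool" where
  "algebraic_over K c \<longleftrightarrow> (\<exists>p. p \<noteq> 0 \<and> (\<forall>i. coeff p i \<in> K) \<and> poly p c = 0)"

lemma mat2_eq_iff: "A = B \<longleftrightarrow> A$1$1 = B$1$1 \<and> A$1$2 = B$1$2 \<and> A$2$1 = B$2$1 \<and> A$2$2 = B$2$2"
  for A B :: "'a^2^2"
  by (auto simp: vec_eq_iff forall_2)

lemma mat2_mult:
  fixes A B :: "int^2^2"
  shows "(A ** B)$1$1 = A$1$1 * B$1$1 + A$1$2 * B$2$1"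
        "(A ** B)$1$2 = A$1$1 * B$1$2 + A$1$2 * B$2$2"
        "(A ** B)$2$1 = A$2$1 * B$1$1 + A$2$2 * B$2$1"
        "(A ** B)$2$2 = A$2$1 * B$1$2 + A$2$2 * B$2$2"
  by (simp_all add: matrix_matrix_mult_def sum_2)

definition adj2 :: "int^2^2 \<Rightarrow> int^2^2" where
  "adj2 A = (\<chi> i j. if i = 1 then (if j = 1 then A$2$2 else - A$1$2)
                            else (if j = 1 then - A$2$1 else A$1$1))"

lemma adj2_nth [simp]:
  "adj2 A$1$1 = A$2$2" "adj2 A$1$2 = - A$1$2" "adj2 A$2$1 = - A$2$1" "adj2 A$2$2 = A$1$1"
  by (simp_all add: adj2_def)

lemma Gamma1_mult:
  assumes "A \<in> Gamma1 N" "B \<in> Gamma1 N"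
  shows "A ** B \<in> Gamma1 N"
proof -
  have "[A$1$1 * B$1$1 + A$1$2 * B$2$1 = 1 * 1 + A$1$2 * 0] (mod int N)"
    using assms by (intro cong_add cong_mult) (auto simp: Gamma1_def)
  moreover have "[A$2$1 * B$1$2 + A$2$2 * B$2$2 = 0 * B$1$2 + 1 * 1] (mod int N)"
    using assms by (intro cong_add cong_mult) (auto simp: Gamma1_def)
  moreover have "[A$2$1 * B$1$1 + A$2$2 * B$2$1 = 0 * B$1$1 + A$2$2 * 0] (mod int N)"
    using assms by (intro cong_add cong_mult) (auto simp: Gamma1_def)
  ultimately show ?thesis
    using assms by (simp add: Gamma1_def det_mul mat2_mult)
qed

lemma Gamma1_one: "mat 1 \<in> Gamma1 N"
  by (simp add: Gamma1_def mat_def det_2)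

lemma Gamma1_adj2: "A \<in> Gamma1 N \<Longrightarrow> adj2 A \<in> Gamma1 N"
  using cong_minus_minus_iff[of "A$2$1" 0 "int N"]
  by (auto simp: Gamma1_def det_2 algebra_simps)

lemma adj2_mult: "det A = 1 \<Longrightarrow> adj2 A ** A = mat 1"
  by (simp add: mat2_eq_iff mat2_mult det_2 mat_def algebra_simps)

lemma Gamma1_coset_self: "A \<in> Gamma1_coset N A"
  unfolding Gamma1_coset_def using Gamma1_one by force

lemma Gamma1_coset_eq:
  assumes "B \<in> Gamma1_coset N A"
  shows "Gamma1_coset N B = Gamma1_coset N A"
proof -
  from assms obtain G where G: "G \<in> Gamma1 N" "B = G ** A"
    by (auto simp: Gamma1_coset_def)
  then have "A = adj2 G ** B"
    using adj2_mult[of G] by (simp add: matrix_mul_assoc Gamma1_def)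
  then show ?thesis
    using G Gamma1_mult Gamma1_adj2 unfolding Gamma1_coset_def
    by (auto simp: matrix_mul_assoc) (metis matrix_mul_assoc)+
qed

lemma Gamma1_coset_cong:
  assumes det: "det A = d" "det B = d" "d > 0"
    and cong: "\<And>i j. [A$i$j = B$i$j] (mod int N * d)"
  shows "B \<in> Gamma1_coset N A"
proof -
  define x where "x i j = (B$i$j - A$i$j) div (int N * d)" for i j
  have x: "B$i$j = A$i$j + int N * d * x i j" for i j
  proof -
    have "int N * d dvd B$i$j - A$i$j"
      using cong[of i j] by (simp add: cong_iff_dvd_diff dvd_diff_commute)
    then show ?thesis by (simp add: x_def dvd_mult_div_cancel)
  qed
  define X :: "int^2^2" where "X = (\<chi> i j. x i j)"
  define Y where "Y = X ** adj2 A"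
  define G :: "int^2^2" where "G = (\<chi> i j. (if i = j then 1 else 0) + int N * Y$i$j)"
  have Gn: "G$1$1 = 1 + int N * Y$1$1" "G$1$2 = int N * Y$1$2"
           "G$2$1 = int N * Y$2$1" "G$2$2 = 1 + int N * Y$2$2"
    by (simp_all add: G_def)
  have dA: "d = A$1$1 * A$2$2 - A$1$2 * A$2$1"
    using det by (simp add: det_2)
  have "G ** A = B"
    unfolding mat2_eq_iff mat2_mult Gn x Y_def X_def dA
    by (simp add: algebra_simps)
  moreover from this have "det G * d = d" using det det_mul[of G A] by simp
  then have "det G = 1" using det by simp
  then have "G \<in> Gamma1 N"
    unfolding Gamma1_def by (simp add: Gn cong_def)
  ultimately show ?thesis by (auto simp: Gamma1_coset_def)
qed

lemma finite_cosets:
  assumes "N \<ge> 1" "det A > 0"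
  shows "finite (Gamma1_coset N ` double_coset N A)"
proof -
  define d where "d = det A"
  define M where "M = int N * d"
  define red where "red = (\<lambda>B::int^2^2. (B$1$1 mod M, B$1$2 mod M, B$2$1 mod M, B$2$2 mod M))"
  have M: "M > 0" using assms by (simp add: M_def d_def)
  have detD: "det B = d" if "B \<in> double_coset N A" for B
    using that by (auto simp: double_coset_def Gamma1_def det_mul d_def)
  have same: "Gamma1_coset N B = Gamma1_coset N C"
    if "B \<in> double_coset N A" "C \<in> double_coset N A" "red B = red C" for B C
  proof -
    have "[C$i$j = B$i$j] (mod int N * d)" for i j
      using that(3) exhaust_2[of i] exhaust_2[of j] by (auto simp: red_def M_def cong_def)
    then show ?thesis
      using Gamma1_coset_cong[of C d B] Gamma1_coset_eq that detD assms by (simp add: d_def)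
  qed
  have "red ` double_coset N A \<subseteq> {0..<M} \<times> {0..<M} \<times> {0..<M} \<times> {0..<M}"
    using M by (auto simp: red_def)
  then have fin: "finite (red ` double_coset N A)"
    by (rule finite_subset) auto
  define pick where "pick = (\<lambda>t. Gamma1_coset N (SOME B. B \<in> double_coset N A \<and> red B = t))"
  have "Gamma1_coset N B = pick (red B)" if "B \<in> double_coset N A" for B
    unfolding pick_def using someI[of "\<lambda>C. C \<in> double_coset N A \<and> red C = red B" B] that
    by (intro same) auto
  then have "Gamma1_coset N ` double_coset N A \<subseteq> pick ` red ` double_coset N A"
    by auto
  with fin show ?thesis by (meson finite_imageI finite_subset)
qed

lemma ex_coset_representatives:
  assumes "N \<ge> 1" "A \<in> Delta1 N"
  shows "\<exists>R. coset_representatives N A R"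
proof -
  define CC where "CC = Gamma1_coset N ` double_coset N A"
  define rep where "rep = (\<lambda>C::(int^2^2) set. SOME B. B \<in> C)"
  have rep: "Gamma1_coset N (rep C) = C" if "C \<in> CC" for C
  proof -
    from that obtain B where B: "C = Gamma1_coset N B" by (auto simp: CC_def)
    then have "rep C \<in> C"
      unfolding rep_def using someI[of "\<lambda>x. x \<in> C" B] Gamma1_coset_self by auto
    with B show ?thesis using Gamma1_coset_eq by auto
  qed
  have sub: "Gamma1_coset N B \<subseteq> double_coset N A" if "B \<in> double_coset N A" for B
    using that Gamma1_mult unfolding Gamma1_coset_def double_coset_def
    by (auto simp: matrix_mul_assoc) blast
  have "finite (rep ` CC)"
    using finite_cosets[of N A] assms by (simp add: CC_def Delta1_def)
  moreover have "disjoint_family_on (Gamma1_coset N) (rep ` CC)"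
    unfolding disjoint_family_on_def using Gamma1_coset_eq rep by (auto, metis)
  moreover have "(\<Union>B\<in>rep ` CC. Gamma1_coset N B) = \<Union>CC"
    using rep by auto
  moreover have "\<Union>CC = double_coset N A"
    using sub Gamma1_coset_self by (fastforce simp: CC_def)
  ultimately show ?thesis unfolding coset_representatives_def by metis
qed

end

theory Submission
  imports Defs
begin

text \<open>
  The last nonzero component \<open>f\<^sub>t\<close> of a \<open>\<Gamma>\<close>-fixed tuple transforms by the diagonal entry of the
  triangular matrix \<open>A\<close>, so it is a \<open>\<Gamma>\<close>-invariant continuous function on \<open>\<real>\<^sup>2 - {0}\<close> that is
  homogeneous of degree \<open>k = \<lambda> - 1 + 2t\<close>. In the chart \<open>g(x) = F(x, 1)\<close>, invariance along the orbit of
  the cusp \<open>\<infinity>\<close> makes \<open>g\<close> constant, and a lower unipotent element of \<open>\<Gamma>\<close> then forces \<open>g = 0\<close> or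
  \<open>k = 0\<close>. Hence \<open>f\<^sub>t\<close> is a constant and \<open>\<lambda> = 1 - 2t\<close> determines \<open>t\<close>; the fixed space has
  dimension at most one, and the eigenvalue, read off from the component \<open>t\<close>, already lies in
  \<open>F\<^sub>\<lambda>\<close>.
\<close>

section \<open>The action on angles and its factor \<open>jfac\<close>\<close>

abbreviation ximg :: "real^2^2 \<Rightarrow> real \<Rightarrow> real" where
  "ximg g \<theta> \<equiv> g$1$1 * cos \<theta> + g$1$2 * sin \<theta>"

abbreviation yimg :: "real^2^2 \<Rightarrow> real \<Rightarrow> real" where
  "yimg g \<theta> \<equiv> g$2$1 * cos \<theta> + g$2$2 * sin \<theta>"

lemma jfac_pos:
  assumes "det g \<noteq> 0"
  shows "jfac g \<theta> > 0"
proof -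
  have "\<not> (ximg g \<theta> = 0 \<and> yimg g \<theta> = 0)"
  proof
    assume 0: "ximg g \<theta> = 0 \<and> yimg g \<theta> = 0"
    have "det g * cos \<theta> = g$2$2 * ximg g \<theta> - g$1$2 * yimg g \<theta>"
         "det g * sin \<theta> = g$1$1 * yimg g \<theta> - g$2$1 * ximg g \<theta>"
      by (simp_all add: det_2 algebra_simps)
    with 0 assms have "cos \<theta> = 0" "sin \<theta> = 0" by auto
    with sin_cos_squared_add[of \<theta>] show False by simp
  qed
  then show ?thesis
    unfolding jfac_def by (simp add: sum_power2_gt_zero_iff)
qed

lemma jfac_sq: "(jfac g \<theta>)\<^sup>2 = (ximg g \<theta>)\<^sup>2 + (yimg g \<theta>)\<^sup>2"
  by (simp add: jfac_def)

text \<open>Both unit vectors are proportional to \<open>(u, v)\<close>, so the sine of the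
  difference of the angles vanishes; two points of \<open>[0, pi)\<close> differ by less than
  \<open>pi\<close>.\<close>

lemma angle_unique:
  assumes "0 \<le> \<phi>" "\<phi> < pi" "0 \<le> \<psi>" "\<psi> < pi" "\<epsilon> \<in> {1, -1::real}" "\<delta> \<in> {1, -1::real}"
    and "cos \<phi> = \<epsilon> * u" "sin \<phi> = \<epsilon> * v" "cos \<psi> = \<delta> * u" "sin \<psi> = \<delta> * v"
  shows "\<phi> = \<psi>"
proof -
  have "sin (\<phi> - \<psi>) = 0"
    using assms(7-) by (simp add: sin_diff)
  moreover have "\<bar>\<phi> - \<psi>\<bar> < pi" using assms(1-4) by auto
  ultimately show ?thesis using sin_eq_0_pi[of "\<phi> - \<psi>"] by auto
qed

lemma angle_act_eqI:
  assumes "0 \<le> \<phi>" "\<phi> < pi" "\<epsilon> \<in> {1, -1}"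
    and "cos \<phi> = \<epsilon> * (ximg g \<theta> / jfac g \<theta>)" "sin \<phi> = \<epsilon> * (yimg g \<theta> / jfac g \<theta>)"
  shows "angle_act g \<theta> = \<phi>"
  unfolding angle_act_def
proof (rule the_equality)
  show "0 \<le> \<phi> \<and> \<phi> < pi \<and> (\<exists>\<epsilon>\<in>{1, -1}. cos \<phi> = \<epsilon> * (ximg g \<theta> / jfac g \<theta>) \<and>
          sin \<phi> = \<epsilon> * (yimg g \<theta> / jfac g \<theta>))"
    using assms by blast
qed (use assms angle_unique in blast)

lemma angle_act_cos_sin:
  assumes "det g \<noteq> 0"
  obtains \<epsilon> where "\<epsilon> \<in> {1, -1}" "cos (angle_act g \<theta>) = \<epsilon> * (ximg g \<theta> / jfac g \<theta>)"
    "sin (angle_act g \<theta>) = \<epsilon> * (yimg g \<theta> / jfac g \<theta>)"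
proof -
  define u v where "u = ximg g \<theta> / jfac g \<theta>" and "v = yimg g \<theta> / jfac g \<theta>"
  have j: "jfac g \<theta> > 0" using jfac_pos assms .
  then have uv: "u\<^sup>2 + v\<^sup>2 = 1"
    by (simp add: u_def v_def power_divide flip: add_divide_distrib jfac_sq)
  \<comment> \<open>This sign moves the unit vector into the closed upper half plane, where it has
    an angle in \<open>[0, pi]\<close>.\<close>
  define \<epsilon> :: real where "\<epsilon> = (if v \<ge> 0 then 1 else -1)"
  have "(\<epsilon> * u)\<^sup>2 + (\<epsilon> * v)\<^sup>2 = 1" "0 \<le> \<epsilon> * v" using uv by (auto simp: \<epsilon>_def)
  then obtain t where t: "0 \<le> t" "t \<le> pi" "\<epsilon> * u = cos t" "\<epsilon> * v = sin t"
    using sincos_total_pi by metis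
  obtain \<phi> \<delta> where "0 \<le> \<phi>" "\<phi> < pi" "\<delta> \<in> {1, -1}" "cos \<phi> = \<delta> * u" "sin \<phi> = \<delta> * v"
  \<comment> \<open>The endpoint \<open>pi\<close> lies outside the half-open interval; it is
    replaced by 0, which reverses the sign.\<close>
  proof (cases "t = pi")
    case True
    with t show ?thesis by (intro that[of 0 "-\<epsilon>"]) (auto simp: \<epsilon>_def split: if_splits)
  next
    case False
    with t show ?thesis by (intro that[of t \<epsilon>]) (auto simp: \<epsilon>_def split: if_splits)
  qed
  then show ?thesis
    using angle_act_eqI[of \<phi> \<delta> g \<theta>] that unfolding u_def v_def by metis
qed

lemma matrix_inverse_unique:
  fixes A :: "'a::semiring_1^'n^'n"
  assumes "A ** B = mat 1" "C ** A = mat 1"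
  shows "C = B"
proof -
  have "C = C ** (A ** B)" by (simp add: assms)
  also have "\<dots> = (C ** A) ** B" by (simp only: matrix_mul_assoc)
  also have "\<dots> = B" by (simp add: assms)
  finally show ?thesis .
qed

text \<open>\<open>matrix_inv\<close> is defined by choice, so the adjugate formula is identified
  with it through uniqueness of a two-sided inverse.\<close>

lemma matrix_inv_2:
  fixes g :: "real^2^2"
  assumes "det g \<noteq> 0"
  shows "matrix_inv g = (\<chi> i j. if i = 1 then (if j = 1 then g$2$2 / det g else - g$1$2 / det g)
                            else (if j = 1 then - g$2$1 / det g else g$1$1 / det g))"
    (is "_ = ?h")
proof -
  have "g ** ?h = mat 1"
    using assms
    by (simp add: vec_eq_iff forall_2 matrix_matrix_mult_def sum_2 mat_def field_simps)
       (simp add: det_2 algebra_simps)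
  moreover from this have "?h ** g = mat 1"
    using matrix_left_right_inverse by blast
  ultimately have "g ** ?h = mat 1 \<and> ?h ** g = mat 1" ..
  then show ?thesis
    unfolding matrix_inv_def
  proof (rule some_equality)
    fix h assume "g ** h = mat 1 \<and> h ** g = mat 1"
    then show "h = ?h"
      using matrix_inverse_unique \<open>g ** ?h = mat 1\<close> by blast
  qed
qed

lemma det_matrix_inv_2:
  fixes g :: "real^2^2"
  assumes "det g \<noteq> 0"
  shows "det (matrix_inv g) = 1 / det g"
proof -
  have "det (matrix_inv g) = (g$1$1 * g$2$2 - g$1$2 * g$2$1) / (det g)\<^sup>2"
    unfolding matrix_inv_2[OF assms] by (simp add: det_2[of "\<chi> i j. _ i j"] power2_eq_square diff_divide_distrib mult.commute)
  also have "\<dots> = 1 / det g" using assms by (simp add: power2_eq_square flip: det_2)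
  finally show ?thesis .
qed

text \<open>The inverse matrix sends the unit vector at angle \<open>angle_act g \<theta>\<close>
  back to plus or minus \<open>(cos \<theta>, sin \<theta>) / jfac g \<theta>\<close>, whose length
  is read off.\<close>

lemma jfac_matrix_inv:
  assumes "det g \<noteq> 0"
  shows "jfac (matrix_inv g) (angle_act g \<theta>) = 1 / jfac g \<theta>"
proof -
  obtain \<epsilon> where e: "\<epsilon> \<in> {1, -1}" "cos (angle_act g \<theta>) = \<epsilon> * (ximg g \<theta> / jfac g \<theta>)"
    "sin (angle_act g \<theta>) = \<epsilon> * (yimg g \<theta> / jfac g \<theta>)"
    using angle_act_cos_sin[OF assms] .
  have j: "jfac g \<theta> > 0" using jfac_pos assms .
  have "ximg (matrix_inv g) (angle_act g \<theta>) =
      \<epsilon> * (g$2$2 * ximg g \<theta> - g$1$2 * yimg g \<theta>) / (det g * jfac g \<theta>)"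
    unfolding e matrix_inv_2[OF assms] using j assms by (simp add: field_simps)
  also have "g$2$2 * ximg g \<theta> - g$1$2 * yimg g \<theta> = det g * cos \<theta>"
    by (simp add: det_2 algebra_simps)
  finally have x: "ximg (matrix_inv g) (angle_act g \<theta>) = \<epsilon> * cos \<theta> / jfac g \<theta>"
    using assms by simp
  have "yimg (matrix_inv g) (angle_act g \<theta>) =
      \<epsilon> * (g$1$1 * yimg g \<theta> - g$2$1 * ximg g \<theta>) / (det g * jfac g \<theta>)"
    unfolding e matrix_inv_2[OF assms] using j assms by (simp add: field_simps)
  also have "g$1$1 * yimg g \<theta> - g$2$1 * ximg g \<theta> = det g * sin \<theta>"
    by (simp add: det_2 algebra_simps)
  finally have y: "yimg (matrix_inv g) (angle_act g \<theta>) = \<epsilon> * sin \<theta> / jfac g \<theta>"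
    using assms by simp
  have "(ximg (matrix_inv g) (angle_act g \<theta>))\<^sup>2 + (yimg (matrix_inv g) (angle_act g \<theta>))\<^sup>2
      = ((cos \<theta>)\<^sup>2 + (sin \<theta>)\<^sup>2) / (jfac g \<theta>)\<^sup>2"
    unfolding x y add_divide_distrib using e(1) by (auto simp: power_divide)
  then show ?thesis
    using j by (simp add: jfac_def[of "matrix_inv g"] real_sqrt_divide)
qed

section \<open>The matrix \<open>A\<close> is triangular, with an explicit diagonal\<close>

lemma ufun_above_diagonal: "int m < j \<Longrightarrow> ufun g lam m j = (\<lambda>\<theta>. 0)"
  by (cases m) auto

text \<open>In the recursion for index \<open>Suc m\<close>, the terms at column
  \<open>Suc m\<close> of the previous row lie above the diagonal and vanish. What is left
  multiplies the previous diagonal entry by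
  \<open>det g / (jfac g \<theta>)\<^sup>2\<close>.\<close>

lemma ufun_diagonal:
  "ufun g lam m (int m) \<theta> =
     complex_of_real ((det g / (jfac g \<theta>)\<^sup>2) ^ m) * complex_of_real (jfac g \<theta>) powr (-1 - lam)"
proof (induction m)
  case (Suc m)
  have "ufun g lam m (1 + int m) = (\<lambda>\<theta>. 0)"
    by (simp add: ufun_above_diagonal)
  then show ?case
    using Suc by (simp add: del_def)
qed simp

lemma Aentry_above_diagonal: "m < n \<Longrightarrow> Aentry g lam \<theta> m n = 0"
  by (simp add: Aentry_def ufun_above_diagonal)

text \<open>Passing to the inverse turns \<open>jfac\<close> into its reciprocal, so with
  \<open>J = jfac g \<theta>\<close> the function \<open>ufun\<close> contributes
  \<open>(J\<^sup>2 / det g) ^ t\<close> and \<open>J powr (1 + lam)\<close>. The prefactor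
  \<open>1 / J\<^sup>2\<close> lowers the total exponent of \<open>J\<close> to
  \<open>lam - 1 + 2 * t\<close>.\<close>

lemma Aentry_diagonal:
  assumes "det g > 0"
  shows "Aentry g lam \<theta> t t = complex_of_real (det g) powr (- lam / 2) / complex_of_real (det g) ^ t
           * complex_of_real (jfac g \<theta>) powr (lam - 1 + 2 * of_nat t)"
proof -
  define J where "J = jfac g \<theta>"
  have J: "J > 0" using jfac_pos assms by (simp add: J_def)
  have "Ln (complex_of_real (1 / J)) = - Ln (complex_of_real J)"
    using J Ln_of_real[of "1 / J"] Ln_of_real[of J] by (simp add: ln_div)
  then have inv: "complex_of_real (1 / J) powr (-1 - lam) = complex_of_real J powr (1 + lam)"
    using J by (simp add: powr_def algebra_simps)
  have pow: "complex_of_real J powr of_nat m = complex_of_real J ^ m" for m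
    using J by (simp add: powr_nat')
  have "complex_of_real J powr (lam - 1 + 2 * of_nat t)
      = complex_of_real J powr ((1 + lam) + of_nat (2 * t) - of_nat 2)"
    by (simp add: algebra_simps)
  also have "\<dots> = complex_of_real J powr (1 + lam) * complex_of_real J ^ (2 * t) / complex_of_real J ^ 2"
    unfolding powr_diff powr_add pow ..
  finally have exponent: "complex_of_real J powr (lam - 1 + 2 * of_nat t)
    = complex_of_real J powr (1 + lam) * complex_of_real J ^ (2 * t) / complex_of_real J ^ 2" .
  have ratio: "det (matrix_inv g) / (jfac (matrix_inv g) (angle_act g \<theta>))\<^sup>2 = J\<^sup>2 / det g"
    using assms by (simp add: jfac_matrix_inv det_matrix_inv_2 J_def power_divide)
  have "jfac (matrix_inv g) (angle_act g \<theta>) = 1 / J"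
    using assms by (simp add: jfac_matrix_inv J_def)
  then have "Aentry g lam \<theta> t t = complex_of_real (det g) powr (- lam / 2)
      * complex_of_real (1 / J\<^sup>2) * (complex_of_real ((J\<^sup>2 / det g) ^ t) * complex_of_real J powr (1 + lam))"
    unfolding Aentry_def ufun_diagonal ratio by (simp only: inv flip: J_def)
  also have "\<dots> = complex_of_real (det g) powr (- lam / 2) / complex_of_real (det g) ^ t
      * (complex_of_real J powr (1 + lam) * complex_of_real J ^ (2 * t) / complex_of_real J ^ 2)"
    by (simp add: power_divide mult.commute flip: power_mult)
  finally show ?thesis by (simp only: exponent flip: J_def)
qed

text \<open>Rows below index \<open>t\<close> contribute nothing to column \<open>t\<close> by
  triangularity, and components beyond \<open>t\<close> vanish by assumption, so a single diagonal
  summand survives.\<close>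

lemma slash_top:
  assumes "det g > 0" "t \<le> s" "\<And>j. j > t \<Longrightarrow> f j = (\<lambda>\<theta>. 0)"
  shows "slash lam s f g t \<theta> = f t (angle_act g \<theta>) *
     (complex_of_real (det g) powr (- lam / 2) / complex_of_real (det g) ^ t
           * complex_of_real (jfac g \<theta>) powr (lam - 1 + 2 * of_nat t))"
proof -
  have "(\<Sum>\<mu>\<le>s. f \<mu> (angle_act g \<theta>) * Aentry g lam \<theta> \<mu> t)
     = (\<Sum>\<mu>\<in>{t}. f \<mu> (angle_act g \<theta>) * Aentry g lam \<theta> \<mu> t)"
    using assms(2,3) Aentry_above_diagonal[of _ t]
    by (intro sum.mono_neutral_right) (auto, metis linorder_neqE_nat)
  then show ?thesis
    using assms(1,2) by (simp add: slash_def Aentry_diagonal)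
qed

section \<open>Invariant homogeneous functions in the affine chart\<close>

text \<open>For \<open>pi\<close>-periodic \<open>h\<close> and invertible \<open>g\<close>, this is
  invariance under \<open>g\<close> of the even function on the punctured plane that is homogeneous
  of degree \<open>k\<close> and restricts to \<open>h\<close> on the unit circle.\<close>

definition invariant_under :: "complex \<Rightarrow> (real \<Rightarrow> complex) \<Rightarrow> real^2^2 \<Rightarrow> bool" where
  "invariant_under k h g \<longleftrightarrow> (\<forall>\<theta>. h (angle_act g \<theta>) * complex_of_real (jfac g \<theta>) powr k = h \<theta>)"

text \<open>The value at \<open>(x, 1)\<close> of the function on \<open>\<real>\<^sup>2 - {0}\<close> that is homogeneous of degree \<open>k\<close>
  and restricts to \<open>h\<close> on the unit circle.\<close>

definition affine_chart :: "complex \<Rightarrow> (real \<Rightarrow> complex) \<Rightarrow> real \<Rightarrow> complex" where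
  "affine_chart k h x = h (pi/2 - arctan x) * complex_of_real (sqrt (1 + x\<^sup>2)) powr k"

text \<open>Both sides are the value of the homogeneous function at the vector
  \<open>(ximg g \<theta>, yimg g \<theta>)\<close>: on the left in polar coordinates, on the right
  after scaling the second coordinate to 1.\<close>

lemma affine_chart_act:
  assumes "yimg g \<theta> > 0"
  shows "h (angle_act g \<theta>) * complex_of_real (jfac g \<theta>) powr k
    = affine_chart k h (ximg g \<theta> / yimg g \<theta>) * complex_of_real (yimg g \<theta>) powr k"
proof -
  define x y where "x = ximg g \<theta>" and "y = yimg g \<theta>"
  have y: "y > 0" using assms by (simp add: y_def)
  have "sqrt (x\<^sup>2 + y\<^sup>2) = sqrt (y\<^sup>2 * (1 + (x / y)\<^sup>2))"
    using y by (simp add: field_simps)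
  also have "\<dots> = y * sqrt (1 + (x / y)\<^sup>2)"
    using y by (simp add: real_sqrt_mult)
  finally have j: "jfac g \<theta> = y * sqrt (1 + (x / y)\<^sup>2)"
    by (simp add: jfac_def x_def y_def)
  have s: "sqrt (1 + (x / y)\<^sup>2) > 0"
    by (simp add: add_pos_nonneg)
  have "angle_act g \<theta> = pi/2 - arctan (x / y)"
  proof (rule angle_act_eqI[where \<epsilon> = 1])
    show "0 \<le> pi/2 - arctan (x / y)" "pi/2 - arctan (x / y) < pi"
      using arctan_bounded[of "x / y"] by auto
    show "cos (pi/2 - arctan (x / y)) = 1 * (ximg g \<theta> / jfac g \<theta>)"
      unfolding j cos_diff using y by (simp add: sin_arctan x_def)
    show "sin (pi/2 - arctan (x / y)) = 1 * (yimg g \<theta> / jfac g \<theta>)"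
      unfolding j sin_diff using y by (simp add: cos_arctan y_def[symmetric])
  qed simp
  moreover have "complex_of_real (jfac g \<theta>) powr k
     = complex_of_real y powr k * complex_of_real (sqrt (1 + (x / y)\<^sup>2)) powr k"
    unfolding j of_real_mult using y s by (intro powr_times_real) auto
  ultimately show ?thesis
    by (simp add: affine_chart_def x_def y_def)
qed

text \<open>Angle 0 is the vector \<open>(1, 0)\<close>, the cusp at infinity; its image is the
  first column of \<open>g\<close>.\<close>

lemma affine_chart_infinity:
  assumes "invariant_under k h g" "g$2$1 > 0"
  shows "affine_chart k h (g$1$1 / g$2$1) * complex_of_real (g$2$1) powr k = h 0"
proof -
  have "affine_chart k h (ximg g 0 / yimg g 0) * complex_of_real (yimg g 0) powr k = h 0"
    using affine_chart_act[of g 0 h k] assms unfolding invariant_under_def by simp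
  then show ?thesis by simp
qed

text \<open>This is invariance at the vector \<open>(x, 1)\<close>. The length \<open>r\<close> of
  that vector cancels because \<open>powr\<close> is multiplicative on positive reals.\<close>

lemma affine_chart_moebius:
  assumes "invariant_under k h g" and d: "g$2$1 * x + g$2$2 > 0"
  shows "affine_chart k h ((g$1$1 * x + g$1$2) / (g$2$1 * x + g$2$2))
           * complex_of_real (g$2$1 * x + g$2$2) powr k = affine_chart k h x"
proof -
  define \<theta> where "\<theta> = pi/2 - arctan x"
  define r where "r = sqrt (1 + x\<^sup>2)"
  have r: "r > 0" by (simp add: r_def add_pos_nonneg)
  have cs: "cos \<theta> = x / r" "sin \<theta> = 1 / r"
    by (simp_all add: \<theta>_def r_def cos_diff sin_diff sin_arctan cos_arctan)
  have X: "ximg g \<theta> = (g$1$1 * x + g$1$2) / r" and Y: "yimg g \<theta> = (g$2$1 * x + g$2$2) / r"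
    by (simp_all add: cs add_divide_distrib)
  have "yimg g \<theta> > 0" unfolding Y using r d by simp
  then have "h \<theta> = affine_chart k h (ximg g \<theta> / yimg g \<theta>) * complex_of_real (yimg g \<theta>) powr k"
    using assms affine_chart_act unfolding invariant_under_def by metis
  then have "affine_chart k h x = affine_chart k h ((g$1$1 * x + g$1$2) / (g$2$1 * x + g$2$2))
      * (complex_of_real (yimg g \<theta>) powr k * complex_of_real r powr k)"
    using r unfolding X Y by (simp add: affine_chart_def \<theta>_def[symmetric] r_def[symmetric])
  also have "complex_of_real (yimg g \<theta>) powr k * complex_of_real r powr k
      = complex_of_real (yimg g \<theta> * r) powr k"
    unfolding of_real_mult using r \<open>yimg g \<theta> > 0\<close> by (intro powr_times_real[symmetric]) auto
  also have "yimg g \<theta> * r = g$2$1 * x + g$2$2"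
    unfolding Y using r by simp
  finally show ?thesis by simp
qed

lemma continuous_affine_chart:
  assumes "continuous_on UNIV h"
  shows "continuous_on UNIV (affine_chart k h)"
proof -
  have pos: "1 + x\<^sup>2 > 0" for x :: real by (simp add: add_pos_nonneg)
  then have "1 + x\<^sup>2 \<noteq> 0" for x :: real by (metis less_irrefl)
  with pos have "continuous_on UNIV (\<lambda>x::real. complex_of_real (sqrt (1 + x\<^sup>2)) powr k)"
    by (intro continuous_intros) (auto simp: complex_nonpos_Reals_iff not_le)
  moreover have "continuous_on UNIV (\<lambda>x. h (pi/2 - arctan x))"
    by (intro continuous_on_compose2[OF assms] continuous_intros) auto
  ultimately show ?thesis
    unfolding affine_chart_def by (rule continuous_on_mult[rotated])
qed

section \<open>Density of the orbit of the cusp and constancy of invariant functions\<close>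

lemma Gamma1_first_column:
  fixes a c :: int
  assumes "coprime a c" "[a = 1] (mod int N)" "[c = 0] (mod int N)"
  obtains G where "G \<in> Gamma1 N" "G$1$1 = a" "G$2$1 = c"
proof -
  obtain u v where uv: "a * u + c * v = 1"
    using bezout_int[of a c] assms(1) by (metis coprime_imp_gcd_eq_1 mult.commute)
  \<comment> \<open>Reducing the Bezout identity modulo \<open>N\<close> forces \<open>u\<close>,
    the lower right entry of the witness, to be congruent to 1.\<close>
  have "[a * u + c * v = 1 * u + 0 * v] (mod int N)"
    using assms by (intro cong_add cong_mult) auto
  then have "[u = 1] (mod int N)"
    by (simp add: uv cong_sym_eq)
  then show ?thesis
    using assms uv
    by (intro that[of "\<chi> i j. if i = 1 then (if j = 1 then a else - v) else (if j = 1 then c else u)"])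
       (auto simp: Gamma1_def det_2 algebra_simps)
qed

lemma map_matrix_nth: "map_matrix f A $ i $ j = f (A $ i $ j)"
  by (simp add: map_matrix_def)

text \<open>The points \<open>(1 + 2Nb) / (2N)\<^sup>n\<close> with fixed \<open>n\<close> are images of \<open>\<infinity>\<close> at which the chart takes the
  same value, and they become dense as \<open>n\<close> grows.\<close>

lemma affine_chart_constant:
  assumes "N \<ge> 1" and cont: "continuous_on UNIV h"
    and inv: "\<And>G. G \<in> Gamma1 N \<Longrightarrow> invariant_under k h (map_matrix real_of_int G)"
  obtains L where "\<And>x. affine_chart k h x = L"
proof -
  \<comment> \<open>The factor 2 ensures that the powers of \<open>M\<close> tend to infinity even
    for \<open>N = 1\<close>.\<close>
  define M :: int where "M = 2 * int N"
  have M: "M \<ge> 2" using assms by (simp add: M_def)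
  \<comment> \<open>The numerator is 1 modulo \<open>M\<close>, hence coprime to the denominator.
    The floor places the point within \<open>1 / M ^ n\<close> of \<open>x\<close>, and the
    denominator does not depend on \<open>x\<close>.\<close>
  define p where "p x n = real_of_int (1 + M * \<lfloor>x * real_of_int M ^ n\<rfloor>) / real_of_int M ^ Suc n" for x n
  have same: "affine_chart k h (p x n) * complex_of_real (real_of_int M ^ Suc n) powr k = h 0" for x n
  proof -
    have "coprime (1 + M * \<lfloor>x * real_of_int M ^ n\<rfloor>) M"
      by (metis coprime_1_left coprime_commute gcd_add_mult coprime_iff_gcd_eq_1 mult.commute add.commute)
    then have "coprime (1 + M * \<lfloor>x * real_of_int M ^ n\<rfloor>) (M ^ Suc n)"
      using coprime_power_right_iff by blast
    moreover have "[1 + M * \<lfloor>x * real_of_int M ^ n\<rfloor> = 1] (mod int N)" "[M ^ Suc n = 0] (mod int N)"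
      by (simp_all add: M_def cong_iff_dvd_diff)
    ultimately obtain G where G: "G \<in> Gamma1 N" "G$1$1 = 1 + M * \<lfloor>x * real_of_int M ^ n\<rfloor>" "G$2$1 = M ^ Suc n"
      using Gamma1_first_column by blast
    show ?thesis
      using affine_chart_infinity[OF inv[OF G(1)]] G M by (simp add: map_matrix_nth p_def)
  qed
  have lim: "p x \<longlonglongrightarrow> x" for x
  proof (rule Lim_null_comparison[THEN Lim_null[THEN iffD2]])
    show "\<forall>\<^sub>F n in sequentially. norm (p x n - x) \<le> 1 / real_of_int M ^ n"
    proof (intro always_eventually allI)
      fix n
      define q where "q = real_of_int M ^ n"
      have q: "q > 0" using M by (simp add: q_def)
      define e where "e = x * q - \<lfloor>x * q\<rfloor>"
      have e: "0 \<le> e" "e < 1" unfolding e_def by linarith+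
      have Mi: "0 < 1 / real_of_int M" "1 / real_of_int M \<le> 1" using M by auto
      have "p x n - x = (1 / real_of_int M - e) / q"
        using q M by (simp add: p_def q_def[symmetric] e_def field_simps)
      moreover have "\<bar>1 / real_of_int M - e\<bar> \<le> 1" using e Mi by linarith
      ultimately show "norm (p x n - x) \<le> 1 / real_of_int M ^ n"
        using q by (simp add: q_def[symmetric] divide_right_mono)
    qed
    show "(\<lambda>n. 1 / real_of_int M ^ n) \<longlonglongrightarrow> 0"
      using M by (intro LIMSEQ_divide_realpow_zero) simp
  qed
  have gp: "(\<lambda>n. affine_chart k h (p x n)) \<longlonglongrightarrow> affine_chart k h x" for x
    using continuous_on_tendsto_compose[OF continuous_affine_chart[OF cont] lim] by simp
  have "affine_chart k h (p x n) = affine_chart k h (p 0 n)" for x n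
  proof -
    have "complex_of_real (real_of_int M ^ Suc n) powr k \<noteq> 0" using M by simp
    then show ?thesis using same[of x n] same[of 0 n] by (metis mult_right_cancel)
  qed
  then have "(\<lambda>n. affine_chart k h (p x n)) = (\<lambda>n. affine_chart k h (p 0 n))" for x
    by blast
  then have "affine_chart k h x = affine_chart k h 0" for x
    using LIMSEQ_unique gp by metis
  then show ?thesis using that by blast
qed

text \<open>For \<open>k\<close> nonzero, taking \<open>c = exp (1 / norm k)\<close> gives a complex
  number of modulus 1 whose exponential is 1. The periods of \<open>exp\<close> are 0 or have
  modulus at least \<open>2 * pi\<close>.\<close>

lemma powr_eq_one_imp_zero:
  fixes k :: complex
  assumes "\<And>c::real. c > 1 \<Longrightarrow> complex_of_real c powr k = 1"
  shows "k = 0"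
proof (rule ccontr)
  assume k: "k \<noteq> 0"
  define u where "u = 1 / norm k"
  have u: "u > 0" using k by (simp add: u_def)
  have "exp (k * complex_of_real u) = 1"
    using assms[of "exp u"] u by (simp add: powr_def Ln_of_real flip: exp_of_real)
  then obtain n :: int where n: "Re (k * complex_of_real u) = 0"
      "Im (k * complex_of_real u) = of_int (2 * n) * pi"
    unfolding exp_eq_1 by blast
  have "1 = norm (k * complex_of_real u)"
    using k by (simp add: u_def norm_mult norm_divide)
  also have "\<dots> = \<bar>of_int (2 * n) * pi\<bar>"
    using cmod_eq_Im[OF n(1)] n(2) by simp
  finally have 1: "1 = 2 * \<bar>real_of_int n\<bar> * pi"
    by (simp add: abs_mult)
  show False
  proof (cases "n = 0")
    case False
    then have "\<bar>real_of_int n\<bar> \<ge> 1" by linarith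
    then have "2 * \<bar>real_of_int n\<bar> * pi \<ge> 2 * 1 * pi" by (intro mult_mono) auto
    then show False using 1 pi_gt3 by linarith
  qed (use 1 in simp)
qed

lemma periodic_int_shift:
  fixes h :: "real \<Rightarrow> 'a"
  assumes "\<And>\<theta>. h (\<theta> + p) = h \<theta>"
  shows "h (\<theta> + of_int n * p) = h \<theta>"
proof -
  have nat: "h (\<phi> + of_nat m * p) = h \<phi>" for \<phi> m
  proof (induction m)
    case (Suc m)
    then show ?case using assms[of "\<phi> + of_nat m * p"] by (simp add: algebra_simps)
  qed simp
  show ?thesis
  proof (cases "n \<ge> 0")
    case True
    then show ?thesis using nat[of \<theta> "nat n"] by simp
  next
    case False
    then show ?thesis using nat[of "\<theta> + of_int n * p" "nat (- n)"] by simp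
  qed
qed

text \<open>The chart covers the angles in \<open>(0, pi)\<close>; continuity adds the endpoints and
  periodicity the rest of the line.\<close>

lemma constant_from_affine_chart:
  fixes h :: "real \<Rightarrow> 'a::t1_space"
  assumes per: "\<And>\<theta>. h (\<theta> + pi) = h \<theta>" and cont: "continuous_on UNIV h"
    and "\<And>x. h (pi/2 - arctan x) = L"
  shows "h \<theta> = L"
proof -
  have open_int: "h \<phi> = L" if "\<phi> \<in> {0<..<pi}" for \<phi>
    using assms(3)[of "tan (pi/2 - \<phi>)"] that by (simp add: arctan_tan)
  have "h ` closure {0<..<pi} \<subseteq> {L}"
  proof (rule image_closure_subset)
    show "continuous_on (closure {0<..<pi}) h" using cont continuous_on_subset by blast
  qed (use open_int in auto)
  then have closed_int: "h \<phi> = L" if "\<phi> \<in> {0..pi}" for \<phi>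
    using that by (auto simp: image_subset_iff)
  have "\<theta> - of_int \<lfloor>\<theta> / pi\<rfloor> * pi \<in> {0..pi}"
  proof -
    have "of_int \<lfloor>\<theta> / pi\<rfloor> \<le> \<theta> / pi" "\<theta> / pi \<le> of_int \<lfloor>\<theta> / pi\<rfloor> + 1" by linarith+
    then have "of_int \<lfloor>\<theta> / pi\<rfloor> * pi \<le> \<theta>" "\<theta> \<le> (of_int \<lfloor>\<theta> / pi\<rfloor> + 1) * pi"
      by (simp_all only: pos_le_divide_eq[OF pi_gt_zero] pos_divide_le_eq[OF pi_gt_zero])
    then show ?thesis by (simp add: algebra_simps)
  qed
  then have "h (\<theta> - of_int \<lfloor>\<theta> / pi\<rfloor> * pi) = L" using closed_int by blast
  moreover have "h (\<theta> - of_int \<lfloor>\<theta> / pi\<rfloor> * pi + of_int \<lfloor>\<theta> / pi\<rfloor> * pi) = h (\<theta> - of_int \<lfloor>\<theta> / pi\<rfloor> * pi)"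
    using per by (rule periodic_int_shift)
  ultimately show ?thesis by simp
qed

lemma Gamma1_invariant_constant:
  assumes "N \<ge> 1" and per: "\<And>\<theta>. h (\<theta> + pi) = h \<theta>" and cont: "continuous_on UNIV h"
    and inv: "\<And>G. G \<in> Gamma1 N \<Longrightarrow> invariant_under k h (map_matrix real_of_int G)"
    and nz: "h \<noteq> (\<lambda>\<theta>. 0)"
  shows "k = 0 \<and> (\<exists>L. \<forall>\<theta>. h \<theta> = L)"
proof -
  obtain L where L: "\<And>x. affine_chart k h x = L"
    using affine_chart_constant[OF assms(1) cont inv] by metis
  have r: "sqrt (1 + x\<^sup>2) \<noteq> 0" for x :: real
    by (metis add_pos_nonneg real_sqrt_gt_0_iff zero_le_power2 zero_less_one less_irrefl)
  have "L \<noteq> 0"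
  proof
    assume "L = 0"
    then have "h (pi/2 - arctan x) = 0" for x
      using L[of x] r[of x] by (simp add: affine_chart_def)
    then show False using constant_from_affine_chart[OF per cont] nz by blast
  qed
  \<comment> \<open>For this lower unipotent matrix the chart identity reads
    \<open>L * (N * x + 1) powr k = L\<close>, and \<open>N * x + 1\<close> takes every value
    \<open>c > 1\<close>.\<close>
  define G :: "int^2^2" where "G = (\<chi> i j. if i = j then 1 else if i = 1 then 0 else int N)"
  have G: "G$1$1 = 1" "G$1$2 = 0" "G$2$1 = int N" "G$2$2 = 1" by (simp_all add: G_def)
  have "G \<in> Gamma1 N" by (simp add: Gamma1_def det_2 G cong_def)
  have "k = 0"
  proof (rule powr_eq_one_imp_zero)
    fix c :: real assume c: "c > 1"
    have "real N * ((c - 1) / real N) + 1 = c" using assms(1) by simp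
    then show "complex_of_real c powr k = 1"
      using affine_chart_moebius[OF inv[OF \<open>G \<in> Gamma1 N\<close>], of "(c - 1) / real N"] c \<open>L \<noteq> 0\<close>
      by (simp add: L G map_matrix_nth)
  qed
  \<comment> \<open>With \<open>k = 0\<close> the factor \<open>sqrt (1 + x\<^sup>2) powr k\<close>
    is 1, so constancy of the chart becomes constancy of \<open>h\<close>.\<close>
  moreover from this have "h (pi/2 - arctan x) = L" for x
    using L[of x] r[of x] by (simp add: affine_chart_def)
  ultimately show ?thesis using constant_from_affine_chart[OF per cont] by blast
qed

section \<open>Fixed tuples: the top component and the dimension\<close>

lemma det_map_matrix_of_int:
  fixes G :: "int^2^2"
  shows "det (map_matrix real_of_int G) = real_of_int (det G)"
  by (simp add: det_2 map_matrix_nth)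

text \<open>Elements of \<open>Gamma1 N\<close> have determinant 1, so \<open>slash_top\<close>
  reduces to invariance of the last nonzero component with exponent \<open>lam - 1 + 2 * t\<close>,
  which must then be 0. Thus \<open>lam\<close> alone fixes \<open>t\<close>, for all nonzero fixed
  tuples at once.\<close>

lemma U_fixed_top:
  assumes "N \<ge> 1" and f: "f \<in> U_fixed N lam s" and "f \<noteq> 0"
  obtains t L where "t \<le> s" "\<And>j. j > t \<Longrightarrow> f j = (\<lambda>\<theta>. 0)" "\<And>\<theta>. f t \<theta> = L" "L \<noteq> 0"
    "lam = 1 - 2 * of_nat t"
proof -
  have U: "\<And>j. j \<le> s \<Longrightarrow> f j \<in> abs_conv_fourier" "\<And>j. j > s \<Longrightarrow> f j = (\<lambda>\<theta>. 0)"
    and fixed: "\<And>G. G \<in> Gamma1 N \<Longrightarrow> slash lam s f (map_matrix real_of_int G) = f"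
    using f by (auto simp: U_fixed_def U_space_def)
  define S where "S = {j. f j \<noteq> (\<lambda>\<theta>. 0)}"
  have "S \<subseteq> {..s}" using U(2) by (force simp: S_def not_le[symmetric])
  then have fin: "finite S" by (rule finite_subset) simp
  have "S \<noteq> {}" using \<open>f \<noteq> 0\<close> by (auto simp: S_def fun_eq_iff)
  define t where "t = Max S"
  have "t \<in> S" using fin \<open>S \<noteq> {}\<close> by (simp add: t_def)
  then have t: "t \<le> s" "f t \<noteq> (\<lambda>\<theta>. 0)" using \<open>S \<subseteq> {..s}\<close> by (auto simp: S_def)
  have above: "f j = (\<lambda>\<theta>. 0)" if "j > t" for j
    using that Max_ge[OF fin, of j] unfolding t_def S_def by fastforce
  have "invariant_under (lam - 1 + 2 * of_nat t) (f t) (map_matrix real_of_int G)"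
    if "G \<in> Gamma1 N" for G
  proof -
    have det: "det (map_matrix real_of_int G) = 1"
      using that by (simp add: det_map_matrix_of_int Gamma1_def)
    have "f t \<theta> = f t (angle_act (map_matrix real_of_int G) \<theta>)
        * complex_of_real (jfac (map_matrix real_of_int G) \<theta>) powr (lam - 1 + 2 * of_nat t)" for \<theta>
      using slash_top[of "map_matrix real_of_int G" t s f lam \<theta>, OF _ t(1) above]
      unfolding fixed[OF that] det by simp
    then show ?thesis unfolding invariant_under_def by metis
  qed
  moreover have "\<And>\<theta>. f t (\<theta> + pi) = f t \<theta>" "continuous_on UNIV (f t)"
    using U(1)[OF t(1)] by (auto simp: abs_conv_fourier_def)
  ultimately have *: "lam - 1 + 2 * of_nat t = 0" "\<exists>L. \<forall>\<theta>. f t \<theta> = L"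
    using Gamma1_invariant_constant[OF assms(1)] t(2) by blast+
  then obtain L where L: "\<And>\<theta>. f t \<theta> = L" by blast
  have "L \<noteq> 0" using L t(2) by auto
  moreover have "lam = 1 - 2 * of_nat t" using *(1) by (simp add: algebra_simps eq_diff_eq)
  ultimately show ?thesis using that t(1) above L by blast
qed

lemma abs_conv_fourier_lincomb:
  assumes "f \<in> abs_conv_fourier" "g \<in> abs_conv_fourier"
  shows "(\<lambda>\<theta>. a * f \<theta> + b * g \<theta>) \<in> abs_conv_fourier"
proof -
  have cont: "continuous_on UNIV f" "continuous_on UNIV g"
    using assms by (auto simp: abs_conv_fourier_def)
  have int: "(\<lambda>\<theta>. h \<theta> * cis (- 2 * of_int n * \<theta>)) integrable_on {0..pi}"
    if "continuous_on UNIV h" for h :: "real \<Rightarrow> complex" and n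
    unfolding cis_conv_exp
    by (intro integrable_continuous_interval continuous_intros continuous_on_subset[OF that]) auto
  have coeff: "fourier_coeff (\<lambda>\<theta>. a * f \<theta> + b * g \<theta>) n
      = a * fourier_coeff f n + b * fourier_coeff g n" for n
  proof -
    have "integral {0..pi} (\<lambda>\<theta>. (a * f \<theta> + b * g \<theta>) * cis (- 2 * of_int n * \<theta>))
        = integral {0..pi} (\<lambda>\<theta>. a * (f \<theta> * cis (- 2 * of_int n * \<theta>))
             + b * (g \<theta> * cis (- 2 * of_int n * \<theta>)))"
      by (simp add: algebra_simps)
    also have "\<dots> = a * integral {0..pi} (\<lambda>\<theta>. f \<theta> * cis (- 2 * of_int n * \<theta>))
             + b * integral {0..pi} (\<lambda>\<theta>. g \<theta> * cis (- 2 * of_int n * \<theta>))"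
      using int cont by (subst integral_add) (auto intro!: integrable_on_mult_right)
    finally show ?thesis by (simp add: fourier_coeff_def algebra_simps)
  qed
  have "(\<lambda>n. norm a * norm (fourier_coeff f n) + norm b * norm (fourier_coeff g n)) summable_on UNIV"
    using assms by (intro summable_on_add summable_on_cmult_right) (auto simp: abs_conv_fourier_def)
  then have "(\<lambda>n. norm (fourier_coeff (\<lambda>\<theta>. a * f \<theta> + b * g \<theta>) n)) summable_on UNIV"
    by (rule summable_on_comparison_test)
       (auto simp: coeff simp flip: norm_mult intro: norm_triangle_ineq)
  then show ?thesis
    using assms cont by (auto simp: abs_conv_fourier_def intro!: continuous_intros)
qed

lemma U_fixed_lincomb:
  assumes "f \<in> U_fixed N lam s" "g \<in> U_fixed N lam s"
  shows "tuple_scale a f + tuple_scale b g \<in> U_fixed N lam s"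
proof -
  have "slash lam s (tuple_scale a f + tuple_scale b g) A
      = tuple_scale a (slash lam s f A) + tuple_scale b (slash lam s g A)" for A
    by (auto simp: slash_def tuple_scale_def fun_eq_iff sum.distrib sum_distrib_left algebra_simps)
  moreover have "tuple_scale a f + tuple_scale b g \<in> U_space s"
    using assms abs_conv_fourier_lincomb
    by (auto simp: U_fixed_def U_space_def tuple_scale_def plus_fun_def)
  ultimately show ?thesis using assms by (simp add: U_fixed_def)
qed

lemma U_fixed_zero: "0 \<in> U_fixed N lam s"
  by (auto simp: U_fixed_def U_space_def slash_def fun_eq_iff abs_conv_fourier_def fourier_coeff_def zero_fun_def)

text \<open>All nonzero fixed tuples have the same top index \<open>t\<close> and a constant
  component there, so any one of them spans the space.\<close>

lemma finite_dim_U_fixed: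
  assumes "N \<ge> 1"
  shows "finite_dim (U_fixed N lam s)"
proof (cases "U_fixed N lam s = {0}")
  case True
  then show ?thesis
    unfolding finite_dim_def by (intro exI[of _ "{}"]) simp
next
  case False
  then obtain f where f: "f \<in> U_fixed N lam s" "f \<noteq> 0" using U_fixed_zero by blast
  obtain t L where tL: "\<And>\<theta>. f t \<theta> = L" "L \<noteq> 0" "lam = 1 - 2 * of_nat t"
    using U_fixed_top[OF assms f] by metis
  have scaled: "tuple_scale a f \<in> U_fixed N lam s" for a
    using U_fixed_lincomb[OF f(1) U_fixed_zero, of a 0] by (simp add: tuple_scale_def zero_fun_def plus_fun_def)
  have "\<exists>a. g = tuple_scale a f" if g: "g \<in> U_fixed N lam s" for g
  proof (cases "g = 0")
    case True
    then show ?thesis by (intro exI[of _ 0]) (simp add: tuple_scale_def fun_eq_iff)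
  next
    case False
    obtain t' L' where t': "\<And>\<theta>. g t' \<theta> = L'" "lam = 1 - 2 * of_nat t'"
      using U_fixed_top[OF assms g False] by metis
    have "t' = t" using t'(2) tL(3) by simp
    \<comment> \<open>The coefficient cancels component \<open>t\<close>. A nonzero \<open>d\<close>
      would be a fixed tuple whose component at that same index is nonzero, so
      \<open>d = 0\<close>.\<close>
    define d where "d = tuple_scale 1 g + tuple_scale (- L' / L) f"
    have d: "d \<in> U_fixed N lam s" unfolding d_def using U_fixed_lincomb g f(1) .
    have "d t \<theta> = 0" for \<theta>
      using t'(1) tL(1,2) \<open>t' = t\<close> by (simp add: d_def tuple_scale_def)
    moreover have "\<exists>t''. lam = 1 - 2 * of_nat t'' \<and> d t'' 0 \<noteq> 0" if "d \<noteq> 0"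
      using U_fixed_top[OF assms d that] by metis
    ultimately have "d = 0" using tL(3) by force
    then have "\<forall>j \<theta>. g j \<theta> + (- L' / L) * f j \<theta> = 0"
      by (auto simp: d_def tuple_scale_def fun_eq_iff)
    then have "g = tuple_scale (L' / L) f"
      by (simp add: tuple_scale_def fun_eq_iff eq_neg_iff_add_eq_0)
    then show ?thesis by blast
  qed
  with scaled have "tuple.span {f} = U_fixed N lam s"
    unfolding tuple.span_singleton by blast
  then show ?thesis
    unfolding finite_dim_def by (intro exI[of _ "{f}"]) simp
qed

section \<open>Subfields and the Hecke eigenvalues\<close>

lemma is_subfield_F_field: "is_subfield (F_field lam)"
  unfolding F_field_def by (rule hull_in) (auto simp: is_subfield_def)

lemma F_field_powr: "n > 0 \<Longrightarrow> complex_of_real (real n) powr (lam / 2) \<in> F_field lam"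
  unfolding F_field_def by (rule hull_inc) auto

lemma subfield_of_nat: "is_subfield K \<Longrightarrow> of_nat n \<in> K"
  by (induction n) (auto simp: is_subfield_def)

lemma subfield_power: "is_subfield K \<Longrightarrow> x \<in> K \<Longrightarrow> x ^ n \<in> K"
  by (induction n) (auto simp: is_subfield_def)

lemma subfield_divide: "is_subfield K \<Longrightarrow> x \<in> K \<Longrightarrow> y \<in> K \<Longrightarrow> x / y \<in> K"
  by (simp add: is_subfield_def divide_inverse)

lemma subfield_sum: "is_subfield K \<Longrightarrow> (\<And>x. x \<in> A \<Longrightarrow> f x \<in> K) \<Longrightarrow> sum f A \<in> K"
  by (induction A rule: infinite_finite_induct) (auto simp: is_subfield_def)

lemma algebraic_over_member:
  assumes "is_subfield K" "c \<in> K"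
  shows "algebraic_over K c"
  unfolding algebraic_over_def
  using assms by (intro exI[of _ "[:-c, 1:]"]) (auto simp: is_subfield_def coeff_pCons split: nat.splits)

lemma hecke_apply: "hecke lam s R f j \<theta> = (\<Sum>B\<in>R. slash lam s f (map_matrix real_of_int B) j \<theta>)"
  unfolding hecke_def by (induction R rule: infinite_finite_induct) auto

lemma coset_representatives_det_pos:
  assumes "coset_representatives N A R" "det A > 0" "B \<in> R"
  shows "det B > 0"
proof -
  have "B \<in> double_coset N A"
    using assms(1,3) Gamma1_coset_self unfolding coset_representatives_def by blast
  then show ?thesis using assms(2) by (auto simp: double_coset_def Gamma1_def det_mul)
qed

text \<open>In the top component the power of \<open>jfac\<close> has exponent 0, so each
  representative \<open>B\<close> multiplies the constant \<open>L\<close> by the number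
  \<open>w B\<close>, which depends only on \<open>det B\<close>. Cancelling \<open>L\<close> shows
  that the eigenvalue is the sum of these numbers.\<close>

lemma hecke_eigenvalue_in_F_field:
  assumes "N \<ge> 1" and pos: "\<And>B. B \<in> R \<Longrightarrow> det B > 0"
    and f: "f \<in> U_fixed N lam s" "f \<noteq> 0" and eig: "hecke lam s R f = tuple_scale c f"
  shows "c \<in> F_field lam"
proof -
  obtain t L where t: "t \<le> s" "\<And>j. j > t \<Longrightarrow> f j = (\<lambda>\<theta>. 0)" "\<And>\<theta>. f t \<theta> = L" "L \<noteq> 0"
    "lam = 1 - 2 * of_nat t"
    using U_fixed_top[OF assms(1) f] by metis
  define w where "w B = complex_of_real (real_of_int (det B)) powr (- lam / 2)
    / complex_of_real (real_of_int (det B)) ^ t" for B :: "int^2^2"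
  have "slash lam s f (map_matrix real_of_int B) t 0 = L * w B" if "B \<in> R" for B
  proof -
    have "det (map_matrix real_of_int B) > 0" using pos[OF that] by (simp add: det_map_matrix_of_int)
    moreover from this have "jfac (map_matrix real_of_int B) 0 > 0" using jfac_pos by force
    moreover have "lam - 1 + 2 * of_nat t = 0" using t(5) by simp
    ultimately show ?thesis
      using slash_top[of "map_matrix real_of_int B" t s f lam 0] t(1-3)
      by (simp add: w_def det_map_matrix_of_int)
  qed
  then have "L * (\<Sum>B\<in>R. w B) = c * L"
    using arg_cong[OF eig, of "\<lambda>F. F t 0"] t(3)
    by (simp add: hecke_apply tuple_scale_def sum_distrib_left)
  then have "c = (\<Sum>B\<in>R. w B)" using t(4) by simp
  moreover have "w B \<in> F_field lam" if "B \<in> R" for B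
  proof -
    define n where "n = nat (det B)"
    have n: "n > 0" "real_of_int (det B) = real n" using pos[OF that] by (auto simp: n_def)
    \<comment> \<open>The negative exponent becomes the reciprocal of a generator of
      \<open>F_field lam\<close>.\<close>
    have "w B = (1 / complex_of_real (real n) powr (lam / 2)) / of_nat n ^ t"
      by (simp add: w_def n powr_minus_divide)
    also have "\<dots> \<in> F_field lam"
      using is_subfield_F_field[of lam] F_field_powr[OF n(1)]
      by (intro subfield_divide subfield_power subfield_of_nat) (auto simp: is_subfield_def)
    finally show ?thesis .
  qed
  ultimately show ?thesis using subfield_sum[OF is_subfield_F_field, of R w lam] by blast
qed

theorem theorem2:
  fixes N s :: nat and lam :: complex
  assumes "N \<ge> 1"
  shows "finite_dim (U_fixed N lam s) \<and>
         (\<forall>\<alpha>\<in>Delta1 N. \<forall>R. coset_representatives N \<alpha> R \<longrightarrow>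
            (\<forall>c\<in>eigenvalues_on (U_fixed N lam s) (hecke lam s R).
               algebraic_over (F_field lam) c))"
proof (intro conjI ballI allI impI)
  show "finite_dim (U_fixed N lam s)" using finite_dim_U_fixed assms .
next
  fix \<alpha> R c
  assume "\<alpha> \<in> Delta1 N" and R: "coset_representatives N \<alpha> R"
    and "c \<in> eigenvalues_on (U_fixed N lam s) (hecke lam s R)"
  then obtain f where "f \<in> U_fixed N lam s" "f \<noteq> 0" "hecke lam s R f = tuple_scale c f"
    by (auto simp: eigenvalues_on_def)
  moreover have "det B > 0" if "B \<in> R" for B
    using coset_representatives_det_pos[OF R _ that] \<open>\<alpha> \<in> Delta1 N\<close> by (simp add: Delta1_def)
  ultimately have "c \<in> F_field lam" using hecke_eigenvalue_in_F_field assms by blast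
  then show "algebraic_over (F_field lam) c" using algebraic_over_member is_subfield_F_field by blast
qed

end
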